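(* Let $G$ be a 2-connected outerplanar near-triangulation on $k$ vertices $v_1,\dots,v_k$, and let $v_k,v_1,v_2$ form a path on the outer cycle of $G$. Then $P(G-\overrightarrow{v_kv_1v_2})$ contains no (non-vanishing) monomial of the form $v_1^0v_2^0v_k^0\prod_{i=3}^{k-1}v_i^{\alpha_i}$ with all $\alpha_i\le2$.
   Context: For a graph $G$, vertices are also variables and $P(G)=\prod_{uv\in E(G),\,u<v}(u-v)$ for a fixed arbitrary orientation. A monomial is contained in $P(G)$ if its coefficient is nonzero. A 2-connected outerplanar near-triangulation is a 2-connected outerplanar graph embedded with all vertices on the outer cycle and all bounded faces triangles. $G-\overrightarrow{v_kv_1v_2}$ is $G$ with edges $v_kv_1,v_1v_2$ deleted (vertices kept). *)

theory Defs
  imports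
    "HOL-Analysis.Analysis"
    "HOL-Library.Poly_Mapping"
    "Graph_Theory.Digraph_Component"
begin

text \<open>
  A finite simple graph is a \<^locale>\<open>pair_graph\<close>: a finite, loop-free, symmetric
  digraph without parallel arcs, in which the edge \<open>uv\<close> is the pair of arcs
  \<open>(u,v)\<close>, \<open>(v,u)\<close>.

  The name \<open>connected\<close> refers to topological connectedness in
  \<^theory>\<open>HOL-Analysis.Analysis\<close>, hence the qualified name below.
\<close>

definition two_connected :: "'a pair_pre_digraph \<Rightarrow> bool" where
  "two_connected G \<longleftrightarrow>
     3 \<le> card (pverts G) \<and> Digraph_Component.connected (with_proj G) \<and>
     (\<forall>u \<in> pverts G. Digraph_Component.connected (pre_digraph.del_vert (with_proj G) u))"

text \<open>In a symmetric digraph \<open>(u,v), (v,u)\<close> is a cycle, which has to be excluded here.\<close>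

definition graph_cycle :: "'a pair_pre_digraph \<Rightarrow> ('a \<times> 'a) list \<Rightarrow> bool" where
  "graph_cycle G C \<longleftrightarrow> pre_digraph.cycle (with_proj G) C \<and> 3 \<le> length C"

text \<open>
  A plane embedding: the vertex \<open>u\<close> is the point \<open>p u\<close>, the edge \<open>uv\<close> is a simple arc,
  given by \<open>\<gamma> (u,v)\<close> when traversed from \<open>u\<close> to \<open>v\<close>; arcs meet only in common ends.
\<close>

definition plane_embedding ::
    "'a pair_pre_digraph \<Rightarrow> ('a \<Rightarrow> complex) \<Rightarrow> ('a \<times> 'a \<Rightarrow> real \<Rightarrow> complex) \<Rightarrow> bool" where
  "plane_embedding G p \<gamma> \<longleftrightarrow>
     inj_on p (pverts G) \<and>
     (\<forall>(u,v) \<in> parcs G.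
        arc (\<gamma> (u,v)) \<and> pathstart (\<gamma> (u,v)) = p u \<and> pathfinish (\<gamma> (u,v)) = p v \<and>
        \<gamma> (v,u) = reversepath (\<gamma> (u,v)) \<and>
        path_image (\<gamma> (u,v)) \<inter> p ` pverts G = {p u, p v}) \<and>
     (\<forall>(u,v) \<in> parcs G. \<forall>(x,y) \<in> parcs G. {u,v} \<noteq> {x,y} \<longrightarrow>
        path_image (\<gamma> (u,v)) \<inter> path_image (\<gamma> (x,y)) \<subseteq> p ` ({u,v} \<inter> {x,y}))"

definition drawing ::
    "'a pair_pre_digraph \<Rightarrow> ('a \<Rightarrow> complex) \<Rightarrow> ('a \<times> 'a \<Rightarrow> real \<Rightarrow> complex) \<Rightarrow> complex set" where
  "drawing G p \<gamma> = p ` pverts G \<union> (\<Union>a \<in> parcs G. path_image (\<gamma> a))"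

definition faces ::
    "'a pair_pre_digraph \<Rightarrow> ('a \<Rightarrow> complex) \<Rightarrow> ('a \<times> 'a \<Rightarrow> real \<Rightarrow> complex) \<Rightarrow> complex set set" where
  "faces G p \<gamma> = components (- drawing G p \<gamma>)"

definition bounded_by_cycle ::
    "'a pair_pre_digraph \<Rightarrow> ('a \<times> 'a \<Rightarrow> real \<Rightarrow> complex) \<Rightarrow> complex set \<Rightarrow> ('a \<times> 'a) list \<Rightarrow> bool" where
  "bounded_by_cycle G \<gamma> F C \<longleftrightarrow>
     graph_cycle G C \<and> frontier F = (\<Union>a \<in> set C. path_image (\<gamma> a))"

text \<open>The outer cycle is determined up to rotation and reversal of the list \<open>C\<close>.\<close>

definition outer_cycle ::
    "'a pair_pre_digraph \<Rightarrow> ('a \<Rightarrow> complex) \<Rightarrow> ('a \<times> 'a \<Rightarrow> real \<Rightarrow> complex) \<Rightarrow> ('a \<times> 'a) list \<Rightarrow> bool" where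
  "outer_cycle G p \<gamma> C \<longleftrightarrow> (\<exists>F \<in> faces G p \<gamma>. \<not> bounded F \<and> bounded_by_cycle G \<gamma> F C)"

definition outerplanar_near_triangulation ::
    "'a pair_pre_digraph \<Rightarrow> ('a \<Rightarrow> complex) \<Rightarrow> ('a \<times> 'a \<Rightarrow> real \<Rightarrow> complex) \<Rightarrow> bool" where
  "outerplanar_near_triangulation G p \<gamma> \<longleftrightarrow>
     pair_graph G \<and> two_connected G \<and> plane_embedding G p \<gamma> \<and>
     (\<exists>C. outer_cycle G p \<gamma> C \<and> fst ` set C = pverts G) \<and>
     (\<forall>F \<in> faces G p \<gamma>. bounded F \<longrightarrow> (\<exists>T. bounded_by_cycle G \<gamma> F T \<and> length T = 3))"

definition delete_path :: "'a pair_pre_digraph \<Rightarrow> 'a \<Rightarrow> 'a \<Rightarrow> 'a \<Rightarrow> 'a pair_pre_digraph" where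
  "delete_path G x y z = G\<lparr>parcs := parcs G - {(x,y), (y,x), (y,z), (z,y)}\<rparr>"

text \<open>
  Integer polynomials with the vertices as variables are finitely supported maps from
  exponent vectors to coefficients, with the convolution product of
  \<^theory>\<open>HOL-Library.Poly_Mapping\<close>.
\<close>

type_synonym 'a vertex_poly = "('a \<Rightarrow>\<^sub>0 nat) \<Rightarrow>\<^sub>0 int"

definition vertex_var :: "'a \<Rightarrow> 'a vertex_poly" where
  "vertex_var u = Poly_Mapping.single (Poly_Mapping.single u 1) 1"

text \<open>\<open>r\<close> is the orientation, \<open>r u v\<close> meaning that \<open>uv\<close> contributes the factor \<open>u - v\<close>;
  a strict linear order on the vertices is an instance.\<close>

definition orients :: "('a \<Rightarrow> 'a \<Rightarrow> bool) \<Rightarrow> 'a pair_pre_digraph \<Rightarrow> bool" where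
  "orients r G \<longleftrightarrow> (\<forall>(u,v) \<in> parcs G. r u v \<longleftrightarrow> \<not> r v u)"

definition graph_poly :: "('a \<Rightarrow> 'a \<Rightarrow> bool) \<Rightarrow> 'a pair_pre_digraph \<Rightarrow> 'a vertex_poly" where
  "graph_poly r G = (\<Prod>(u,v) \<in> {(u,v) \<in> parcs G. r u v}. vertex_var u - vertex_var v)"

definition contains_monomial :: "'a vertex_poly \<Rightarrow> ('a \<Rightarrow>\<^sub>0 nat) \<Rightarrow> bool" where
  "contains_monomial P m \<longleftrightarrow> Poly_Mapping.lookup P m \<noteq> 0"

end

theory Submission
  imports Defs
begin

text \<open>
  Only degrees matter. Deleting two of at least \<open>2 k - 3\<close> edges leaves a homogeneous polynomial
  of degree at least \<open>2 k - 5\<close>, whereas a monomial of the stated form has degree at most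
  \<open>2 (k - 3)\<close>. The bound on the number of edges comes from a count of the edges drawn inside a
  cycle of length \<open>n\<close> with no vertex inside: if there are none, the inside is a bounded face and
  \<open>n = 3\<close>; otherwise such an edge is a chord, and the two shorter cycles into which it splits
  the given one have lengths adding up to \<open>n + 2\<close>, so by induction there are at least
  \<open>n - 3\<close> edges inside. For a Hamiltonian cycle this gives \<open>k + (k - 3)\<close> edges.
\<close>

section \<open>Arcs of walks and cycles given by vertex lists\<close>

fun walk_arcs :: "'a list \<Rightarrow> ('a \<times> 'a) set" where
  "walk_arcs (x # y # zs) = insert (x, y) (walk_arcs (y # zs))"
| "walk_arcs _ = {}"

text \<open>Appending \<open>hd xs\<close> closes the walk. On the empty list the unspecified
  \<open>hd []\<close> does no harm, since a single vertex has no arcs.\<close>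

definition cycle_arcs :: "'a list \<Rightarrow> ('a \<times> 'a) set" where
  "cycle_arcs xs = walk_arcs (xs @ [hd xs])"

lemma walk_arcs_append: "walk_arcs (xs @ y # ys) = walk_arcs (xs @ [y]) \<union> walk_arcs (y # ys)"
  by (induction xs rule: walk_arcs.induct) auto

lemma Field_walk_arcs_subset: "Field (walk_arcs xs) \<subseteq> set xs"
  by (induction xs rule: walk_arcs.induct) (auto simp: Field_def)

lemma walk_arcs_mem: "(u, v) \<in> walk_arcs xs \<Longrightarrow> u \<in> set xs \<and> v \<in> set xs"
  by (induction xs rule: walk_arcs.induct) auto

lemma walk_arcs_neq: "distinct xs \<Longrightarrow> (u, v) \<in> walk_arcs xs \<Longrightarrow> u \<noteq> v"
  by (induction xs rule: walk_arcs.induct) (auto dest: walk_arcs_mem)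

text \<open>An arc of the walk joins consecutive entries, and by distinctness the nonempty
  \<open>A\<close> separates \<open>a\<close> from \<open>b\<close>.\<close>

lemma ends_notin_walk_arcs:
  assumes "distinct (a # A @ [b])" "A \<noteq> []"
  shows "(a, b) \<notin> walk_arcs (a # A @ [b])" "(b, a) \<notin> walk_arcs (a # A @ [b])"
proof -
  from assms obtain x A' where A: "A = x # A'" by (cases A) auto
  show "(a, b) \<notin> walk_arcs (a # A @ [b])" "(b, a) \<notin> walk_arcs (a # A @ [b])"
    using assms unfolding A by (auto dest: walk_arcs_mem)
qed

lemma cycle_arcs_conv: "cycle_arcs (a # A @ b # B) = walk_arcs (a # A @ [b]) \<union> walk_arcs (b # B @ [a])"
  unfolding cycle_arcs_def using walk_arcs_append[of "a # A" b "B @ [a]"] by simp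

lemma cycle_arcs_rotate:
  assumes "xs \<noteq> []" "ys \<noteq> []"
  shows "cycle_arcs (xs @ ys) = cycle_arcs (ys @ xs)"
proof -
  obtain x xs' y ys' where "xs = x # xs'" "ys = y # ys'" using assms by (meson list.exhaust)
  then show ?thesis
    using cycle_arcs_conv[of x xs' y ys'] cycle_arcs_conv[of y ys' x xs'] by auto
qed

text \<open>Rotating the list brings \<open>a\<close> to the front, and \<open>b\<close> then cuts
  the rest. This is how a cycle is cut at the ends of a chord; \<open>A\<close> and \<open>B\<close>
  may be empty.\<close>

lemma cycle_arcs_split:
  assumes "distinct xs" "a \<in> set xs" "b \<in> set xs" "a \<noteq> b"
  obtains A B where "distinct (a # A @ b # B)" "length xs = length A + length B + 2"
    "cycle_arcs xs = walk_arcs (a # A @ [b]) \<union> walk_arcs (b # B @ [a])"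
proof -
  obtain ys zs where xs: "xs = ys @ a # zs" using assms(2) by (meson split_list)
  have "b \<in> set (zs @ ys)" using assms xs by auto
  then obtain A B where AB: "zs @ ys = A @ b # B" by (meson split_list)
  have "cycle_arcs xs = cycle_arcs (a # A @ b # B)"
    unfolding xs using cycle_arcs_rotate[of ys "a # zs"] AB by (cases "ys = []") auto
  moreover have "length xs = length A + length B + 2"
    using arg_cong[OF AB, of length] unfolding xs by simp
  moreover have "distinct (a # A @ b # B)"
    using assms(1) unfolding AB[symmetric] xs by auto
  ultimately show thesis using that cycle_arcs_conv by metis
qed

lemma cycle_arcs_split_ends:
  assumes "distinct xs" "3 \<le> length xs"
  obtains a A b where "xs = a # A @ [b]" "A \<noteq> []" "cycle_arcs xs = insert (b, a) (walk_arcs xs)"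
proof -
  obtain a ys where xs: "xs = a # ys" using assms(2) by (cases xs) auto
  obtain A b where ys: "ys = A @ [b]" using assms(2) xs by (cases ys rule: rev_cases) auto
  show thesis
    using assms(2) cycle_arcs_conv[of a A b "[]"] by (intro that[of a A b]) (auto simp: xs ys)
qed

lemma Field_cycle_arcs_subset: "Field (cycle_arcs xs) \<subseteq> set xs"
  using Field_walk_arcs_subset[of "xs @ [hd xs]"]
  by (cases xs) (auto simp: cycle_arcs_def)

lemma fst_cycle_arcs: "fst ` cycle_arcs xs = set xs"
proof -
  have "fst ` walk_arcs (ys @ [z]) = set ys" for ys :: "'a list" and z
    by (induction ys rule: walk_arcs.induct) auto
  then show ?thesis by (simp add: cycle_arcs_def)
qed

text \<open>For two vertices this fails, as both arcs of the edge would occur. It ensures that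
  passing from the arcs of a cycle to unordered edges loses none.\<close>

lemma cycle_arcs_antisym:
  assumes "distinct xs" "3 \<le> length xs" "(u, v) \<in> cycle_arcs xs"
  shows "(v, u) \<notin> cycle_arcs xs"
proof
  assume vu: "(v, u) \<in> cycle_arcs xs"
  have walk: "\<lbrakk>distinct ys; (u, v) \<in> walk_arcs ys; (v, u) \<in> walk_arcs ys\<rbrakk> \<Longrightarrow> False"
    for ys :: "'a list"
    by (induction ys rule: walk_arcs.induct) (auto dest: walk_arcs_mem)
  obtain a A b where *: "xs = a # A @ [b]" "A \<noteq> []" "cycle_arcs xs = insert (b, a) (walk_arcs xs)"
    using cycle_arcs_split_ends assms by metis
  then show False
    using assms vu walk[of xs] ends_notin_walk_arcs[of a A b] by auto
qed

text \<open>Every entry of the list is the start of an arc.\<close>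

lemma card_cycle_arcs_ge:
  "length xs \<le> card (cycle_arcs xs)" if "distinct xs"
proof -
  have "finite (walk_arcs ys)" for ys :: "'a list"
    by (induction ys rule: walk_arcs.induct) auto
  then have "card (fst ` cycle_arcs xs) \<le> card (cycle_arcs xs)"
    unfolding cycle_arcs_def by (intro card_image_le)
  then show ?thesis using that by (simp add: fst_cycle_arcs distinct_card)
qed

section \<open>Cycles as arc lists and as vertex lists\<close>

lemma pcas_imp_pawalk_verts: "pcas u C w \<Longrightarrow> pawalk_verts u C = map fst C @ [w]"
  by (induction C arbitrary: u) auto

lemma pcas_imp_set_eq_walk_arcs: "pcas u C w \<Longrightarrow> set C = walk_arcs (map fst C @ [w])"
proof (induction C arbitrary: u)
  case (Cons e es)
  have "set es = walk_arcs (map fst es @ [w])" using Cons.IH[of "snd e"] Cons.prems by simp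
  moreover have "hd (map fst es @ [w]) = snd e" using Cons.prems by (cases es) simp_all
  moreover have "walk_arcs (map fst (e # es) @ [w]) =
      insert (fst e, hd (map fst es @ [w])) (walk_arcs (map fst es @ [w]))"
    by (cases es) simp_all
  ultimately show ?case by simp
qed simp

lemma graph_cycle_vertex_list:
  assumes "graph_cycle G C"
  obtains xs where "distinct xs" "length xs = length C" "3 \<le> length xs" "set C = cycle_arcs xs"
    "cycle_arcs xs \<subseteq> parcs G"
proof -
  interpret pair_pre_digraph G .
  obtain u where u: "set C \<subseteq> parcs G" "pcas u C u" "distinct (tl (pawalk_verts u C))"
    and len: "3 \<le> length C"
    using assms unfolding graph_cycle_def cycle_def awalk_def by auto
  obtain e es where C: "C = e # es" using len by (cases C) auto
  have hd: "fst e = u" using u C by simp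
  have "pawalk_verts u C = map fst C @ [u]" using u(2) by (rule pcas_imp_pawalk_verts)
  \<comment> \<open>\<open>pawalk_verts u C\<close> begins and ends with \<open>u\<close>: the tail
    in \<open>u(3)\<close> drops the first copy, \<open>map fst C\<close> the last one.\<close>
  then have "distinct (map fst C)" using u(3) C hd by auto
  moreover have "set C = cycle_arcs (map fst C)"
    using pcas_imp_set_eq_walk_arcs[OF u(2)] C hd by (simp add: cycle_arcs_def)
  ultimately show thesis using that[of "map fst C"] u(1) len by simp
qed

section \<open>Curves of walks and cycles in the plane\<close>

text \<open>The set is the image of a half-open interval. It serves for an edge with one end
  removed.\<close>

lemma connected_arc_minus_pathfinish:
  fixes g :: "real \<Rightarrow> 'b::real_normed_vector"
  assumes "arc g"
  shows "Topological_Spaces.connected (path_image g - {pathfinish g})"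
proof -
  have "{0..1::real} = insert 1 {0..<1}" by auto
  then have "path_image g = insert (pathfinish g) (g ` {0..<1})"
    by (simp add: path_image_def pathfinish_def)
  moreover have "pathfinish g \<notin> g ` {0..<1}"
    using inj_on_image_mem_iff[of g "{0..1}" 1 "{0..<1}"] assms
    by (simp add: arc_def pathfinish_def subset_iff)
  ultimately have "path_image g - {pathfinish g} = g ` {0..<1}" by simp
  moreover have "continuous_on {0..<1} g"
    using assms by (auto simp: arc_def path_def intro: continuous_on_subset)
  ultimately show ?thesis
    by (metis connected_Ico connected_continuous_image)
qed

locale plane_graph = pair_graph G for G :: "'a pair_pre_digraph" +
  fixes p :: "'a \<Rightarrow> complex" and \<gamma> :: "'a \<times> 'a \<Rightarrow> real \<Rightarrow> complex"
  assumes embedding: "plane_embedding G p \<gamma>"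
begin

definition curve :: "('a \<times> 'a) set \<Rightarrow> complex set" where
  "curve A = (\<Union>a\<in>A. path_image (\<gamma> a))"

lemma curve_simps [simp]:
  "curve {} = {}" "curve (insert a A) = path_image (\<gamma> a) \<union> curve A" "curve (A \<union> B) = curve A \<union> curve B"
  by (auto simp: curve_def)

lemma p_eq_iff: "u \<in> pverts G \<Longrightarrow> v \<in> pverts G \<Longrightarrow> p u = p v \<longleftrightarrow> u = v"
  using embedding by (auto simp: plane_embedding_def inj_on_def)

lemma arc_flip: "(u, v) \<in> parcs G \<Longrightarrow> (v, u) \<in> parcs G"
  using pair_sym_arcs by (auto simp: symmetric_def sym_def)

lemma no_loop: "(u, v) \<in> parcs G \<Longrightarrow> u \<noteq> v"
  using pair_no_loops by fastforce

lemma edge_ends_neq: "(u, v) \<in> parcs G \<Longrightarrow> p u \<noteq> p v"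
  using p_eq_iff[OF in_arcsD1 in_arcsD2] no_loop by simp

lemma edge_curve:
  assumes "(u, v) \<in> parcs G"
  shows "Path_Connected.arc (\<gamma> (u, v))" "pathstart (\<gamma> (u, v)) = p u" "pathfinish (\<gamma> (u, v)) = p v"
    "\<gamma> (v, u) = reversepath (\<gamma> (u, v))" "path_image (\<gamma> (v, u)) = path_image (\<gamma> (u, v))"
    "path_image (\<gamma> (u, v)) \<inter> p ` pverts G = {p u, p v}"
proof -
  show "Path_Connected.arc (\<gamma> (u, v))" "pathstart (\<gamma> (u, v)) = p u" "pathfinish (\<gamma> (u, v)) = p v"
    and rev: "\<gamma> (v, u) = reversepath (\<gamma> (u, v))"
    and "path_image (\<gamma> (u, v)) \<inter> p ` pverts G = {p u, p v}"
    using assms embedding unfolding plane_embedding_def by fast+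
  show "path_image (\<gamma> (v, u)) = path_image (\<gamma> (u, v))" by (simp add: rev)
qed

lemma edge_curve_Int:
  assumes "(u, v) \<in> parcs G" "(x, y) \<in> parcs G" "{u, v} \<noteq> {x, y}"
  shows "path_image (\<gamma> (u, v)) \<inter> path_image (\<gamma> (x, y)) \<subseteq> p ` ({u, v} \<inter> {x, y})"
proof -
  have "\<forall>(u, v)\<in>parcs G. \<forall>(x, y)\<in>parcs G. {u, v} \<noteq> {x, y} \<longrightarrow>
      path_image (\<gamma> (u, v)) \<inter> path_image (\<gamma> (x, y)) \<subseteq> p ` ({u, v} \<inter> {x, y})"
    using embedding unfolding plane_embedding_def by (elim conjE)
  from bspec[OF this assms(1), unfolded prod.case, THEN bspec, OF assms(2)] assms(3)
  show ?thesis unfolding prod.case by (rule mp)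
qed

text \<open>Edges that differ as unordered pairs meet only in common ends; hence an arc of
  \<open>A\<close> must not recur in \<open>B\<close> in either direction.\<close>

lemma curve_Int_subset:
  assumes "A \<subseteq> parcs G" "B \<subseteq> parcs G" "\<And>u v. (u, v) \<in> A \<Longrightarrow> (u, v) \<notin> B \<and> (v, u) \<notin> B"
  shows "curve A \<inter> curve B \<subseteq> p ` (Field A \<inter> Field B)"
proof
  fix z assume "z \<in> curve A \<inter> curve B"
  then obtain u v x y where *: "(u, v) \<in> A" "(x, y) \<in> B" "z \<in> path_image (\<gamma> (u, v))" "z \<in> path_image (\<gamma> (x, y))"
    by (auto simp: curve_def)
  have "{u, v} \<noteq> {x, y}" using assms(3)[OF *(1)] *(2) by (auto simp: doubleton_eq_iff)
  then have "z \<in> p ` ({u, v} \<inter> {x, y})"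
    using edge_curve_Int[of u v x y] * assms(1,2) by blast
  moreover have "{u, v} \<inter> {x, y} \<subseteq> Field A \<inter> Field B" using * by (auto simp: Field_def)
  ultimately show "z \<in> p ` (Field A \<inter> Field B)" by blast
qed

text \<open>Away from the vertices a point lies on at most one edge, so such a point identifies its
  edge.\<close>

lemma interior_point:
  assumes "(u, v) \<in> parcs G"
  obtains z where "z \<in> path_image (\<gamma> (u, v))" "z \<notin> p ` pverts G"
proof -
  have "path_image (\<gamma> (u, v)) - {p u, p v} \<noteq> {}"
    using nonempty_simple_path_endless[OF arc_imp_simple_path[OF edge_curve(1)[OF assms]]]
    unfolding edge_curve(2,3)[OF assms] .
  then show thesis using that edge_curve(6)[OF assms] by blast
qed

text \<open>The edges are joined one after another: as \<open>x\<close> does not recur, the first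
  edge meets the rest of the walk only in \<open>p y\<close>.\<close>

lemma walk_curve:
  assumes "distinct xs" "2 \<le> length xs" "walk_arcs xs \<subseteq> parcs G"
  shows "\<exists>g. Path_Connected.arc g \<and> pathstart g = p (hd xs) \<and> pathfinish g = p (last xs) \<and> path_image g = curve (walk_arcs xs)"
  using assms
proof (induction xs rule: walk_arcs.induct)
  case (1 x y zs)
  then have xy: "(x, y) \<in> parcs G" by simp
  show ?case
  proof (cases zs)
    case Nil
    then show ?thesis using edge_curve[OF xy] by (intro exI[of _ "\<gamma> (x, y)"]) auto
  next
    case (Cons z zs')
    then obtain g where g: "Path_Connected.arc g" "pathstart g = p y" "pathfinish g = p (last (y # zs))"
      "path_image g = curve (walk_arcs (y # zs))"
      using 1 by auto
    have "curve {(x, y)} \<inter> curve (walk_arcs (y # zs)) \<subseteq> p ` (Field {(x, y)} \<inter> Field (walk_arcs (y # zs)))"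
      using 1 by (intro curve_Int_subset) (auto dest: walk_arcs_mem)
    also have "\<dots> \<subseteq> {p y}"
      using 1(2) Field_walk_arcs_subset[of "y # zs"] by (auto simp: Field_def)
    finally have "Path_Connected.arc (\<gamma> (x, y) +++ g)"
      using g edge_curve[OF xy] by (intro arc_join) auto
    then show ?thesis using g edge_curve[OF xy]
      by (intro exI[of _ "\<gamma> (x, y) +++ g"]) (auto simp: path_image_join)
  qed
qed auto

lemma ends_in_walk_curve:
  assumes "walk_arcs (a # A @ [b]) \<subseteq> parcs G"
  shows "p a \<in> curve (walk_arcs (a # A @ [b]))" "p b \<in> curve (walk_arcs (a # A @ [b]))"
proof -
  obtain x B where 1: "A @ [b] = x # B" by (cases A) auto
  then have "(a, x) \<in> parcs G" using assms by simp
  from edge_curve(6)[OF this] show "p a \<in> curve (walk_arcs (a # A @ [b]))"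
    unfolding 1 by auto
  obtain y D where 2: "a # A = D @ [y]" by (cases "a # A" rule: rev_cases) auto
  then have 3: "a # A @ [b] = D @ y # [b]" by (metis append.assoc append_Cons append_Nil)
  then have "(y, b) \<in> parcs G" using assms walk_arcs_append[of D y "[b]"] unfolding 3 by simp
  from edge_curve(6)[OF this] show "p b \<in> curve (walk_arcs (a # A @ [b]))"
    unfolding 3 walk_arcs_append[of D y "[b]"] by auto
qed

text \<open>A nonempty \<open>A\<close> rules out that both walks use the edge between
  \<open>a\<close> and \<open>b\<close>. \<open>B\<close> may be empty, which covers a walk closed
  up by a single edge.\<close>

lemma walk_curves_Int:
  assumes "distinct (a # A @ b # B)" "A \<noteq> []"
    "walk_arcs (a # A @ [b]) \<subseteq> parcs G" "walk_arcs (b # B @ [a]) \<subseteq> parcs G"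
  shows "curve (walk_arcs (a # A @ [b])) \<inter> curve (walk_arcs (b # B @ [a])) = {p a, p b}"
proof
  let ?V = "walk_arcs (a # A @ [b])" and ?W = "walk_arcs (b # B @ [a])"
  have "(u, v) \<notin> ?W \<and> (v, u) \<notin> ?W" if uv: "(u, v) \<in> ?V" for u v
  proof (rule ccontr)
    assume "\<not> ?thesis"
    then have "u \<in> {a, b}" "v \<in> {a, b}" using uv assms(1) by (auto dest!: walk_arcs_mem)
    moreover have "u \<noteq> v" using uv assms(1) walk_arcs_neq[of "a # A @ [b]"] by auto
    ultimately show False using uv ends_notin_walk_arcs[of a A b] assms(1,2) by auto
  qed
  then have "curve ?V \<inter> curve ?W \<subseteq> p ` (Field ?V \<inter> Field ?W)"
    using assms by (intro curve_Int_subset) auto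
  also have "\<dots> \<subseteq> {p a, p b}"
    using assms(1) Field_walk_arcs_subset[of "a # A @ [b]"] Field_walk_arcs_subset[of "b # B @ [a]"] by auto
  finally show "curve ?V \<inter> curve ?W \<subseteq> {p a, p b}" .
  show "{p a, p b} \<subseteq> curve ?V \<inter> curve ?W"
    using ends_in_walk_curve[OF assms(3)] ends_in_walk_curve[OF assms(4)] by auto
qed

lemma cycle_curve:
  assumes "distinct xs" "3 \<le> length xs" "cycle_arcs xs \<subseteq> parcs G"
  obtains g where "simple_path g" "pathfinish g = pathstart g" "path_image g = curve (cycle_arcs xs)"
proof -
  obtain a A b where *: "xs = a # A @ [b]" "A \<noteq> []" "cycle_arcs xs = insert (b, a) (walk_arcs xs)"
    using cycle_arcs_split_ends[OF assms(1,2)] by metis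
  obtain g where g: "Path_Connected.arc g" "pathstart g = p a" "pathfinish g = p b" "path_image g = curve (walk_arcs xs)"
    using walk_curve[of xs] assms * by auto
  have ba: "(b, a) \<in> parcs G" using assms(3) * by auto
  have "curve (walk_arcs xs) \<inter> path_image (\<gamma> (b, a)) = {p a, p b}"
    using walk_curves_Int[of a A b "[]"] assms * by auto
  then have "simple_path (g +++ \<gamma> (b, a))"
    using g edge_curve[OF ba] by (intro simple_path_join_loop) auto
  moreover have "path_image (g +++ \<gamma> (b, a)) = curve (cycle_arcs xs)"
    using g edge_curve[OF ba] *(3) by (simp add: path_image_join Un_commute)
  ultimately show thesis
    using that g edge_curve[OF ba] by simp
qed

text \<open>This is the Jordan curve theorem for the closed curve of a cycle.\<close>

lemma cycle_region:
  assumes "distinct xs" "3 \<le> length xs" "cycle_arcs xs \<subseteq> parcs G"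
  defines "J \<equiv> curve (cycle_arcs xs)"
  shows "open (inside J)" "Topological_Spaces.connected (inside J)" "inside J \<noteq> {}" "bounded (inside J)"
    "frontier (inside J) = J"
proof -
  obtain g where g: "simple_path g" "pathfinish g = pathstart g" "path_image g = J"
    using cycle_curve[OF assms(1-3)] unfolding J_def by metis
  show "open (inside J)" "Topological_Spaces.connected (inside J)" "inside J \<noteq> {}" "bounded (inside J)"
    "frontier (inside J) = J"
    using Jordan_inside_outside[OF g(1,2)] unfolding g(3) by auto
qed

section \<open>Edges inside a cycle that encloses no vertex\<close>

text \<open>Edges are unordered here, so that each is counted once and not as two arcs.\<close>

definition inner_edges :: "complex set \<Rightarrow> 'a set set" where
  "inner_edges J = {{u, v} | u v. (u, v) \<in> parcs G \<and> path_image (\<gamma> (u, v)) \<inter> inside J \<noteq> {}}"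

lemma finite_inner_edges: "finite (inner_edges J)"
proof -
  have "inner_edges J \<subseteq> (\<lambda>(u, v). {u, v}) ` parcs G" by (auto simp: inner_edges_def)
  then show ?thesis using finite_surj pair_finite_arcs by blast
qed

context
  fixes xs u v J
  assumes xs: "distinct xs" "3 \<le> length xs" "cycle_arcs xs \<subseteq> parcs G"
    and empty: "p ` pverts G \<inter> inside J = {}"
    and uv: "(u, v) \<in> parcs G" "path_image (\<gamma> (u, v)) \<inter> inside J \<noteq> {}"
    and J: "J = curve (cycle_arcs xs)"
begin

text \<open>An edge of the cycle lies on \<open>J\<close>, which is disjoint from its
  inside.\<close>

lemma inner_edge_notin_cycle: "(u, v) \<notin> cycle_arcs xs" "(v, u) \<notin> cycle_arcs xs"
proof -
  have "\<not> path_image (\<gamma> (u, v)) \<subseteq> J" using uv(2) inside_no_overlap[of J] by blast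
  moreover have "(x, y) \<in> cycle_arcs xs \<Longrightarrow> path_image (\<gamma> (x, y)) \<subseteq> J" for x y
    unfolding J curve_def by blast
  ultimately show "(u, v) \<notin> cycle_arcs xs" "(v, u) \<notin> cycle_arcs xs"
    using edge_curve(5)[OF uv(1)] by metis+
qed

lemma inner_edge_Int_cycle: "path_image (\<gamma> (u, v)) \<inter> J \<subseteq> p ` ({u, v} \<inter> set xs)"
proof -
  have "curve {(u, v)} \<inter> curve (cycle_arcs xs) \<subseteq> p ` (Field {(u, v)} \<inter> Field (cycle_arcs xs))"
    using uv(1) xs(3) inner_edge_notin_cycle by (intro curve_Int_subset) auto
  also have "\<dots> \<subseteq> p ` ({u, v} \<inter> set xs)"
    using Field_cycle_arcs_subset[of xs] by (intro image_mono Int_mono) (auto simp: Field_def)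
  finally show ?thesis by (simp add: J)
qed

text \<open>Without its ends the edge is connected and, by \<open>inner_edge_Int_cycle\<close>,
  disjoint from \<open>J\<close>, the frontier of the inside; so it cannot leave the inside.\<close>

lemma inner_edge_subset_inside: "path_image (\<gamma> (u, v)) - {p u, p v} \<subseteq> inside J"
proof (rule ccontr)
  let ?S = "path_image (\<gamma> (u, v)) - {p u, p v}"
  assume "\<not> ?S \<subseteq> inside J"
  moreover have "Topological_Spaces.connected ?S"
    using connected_simple_path_endless[OF arc_imp_simple_path[OF edge_curve(1)[OF uv(1)]]]
      edge_curve[OF uv(1)] by simp
  moreover have "?S \<inter> inside J \<noteq> {}"
    using uv(2) empty in_arcsD1[OF uv(1)] in_arcsD2[OF uv(1)] by auto
  ultimately have "?S \<inter> J \<noteq> {}"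
    using connected_Int_frontier[of ?S "inside J"] cycle_region[OF xs] J by auto
  then show False using inner_edge_Int_cycle by auto
qed

text \<open>Here only \<open>p v\<close> is removed. The rest joins \<open>p u\<close>, which is not
  inside, to a point inside, so it meets \<open>J\<close>, and \<open>p u\<close> is the only place
  where it can. The other end is treated by reversing the edge.\<close>

lemma inner_edge_start_in_cycle: "u \<in> set xs"
proof -
  let ?S = "path_image (\<gamma> (u, v)) - {p v}"
  have ne: "p u \<noteq> p v"
    using edge_ends_neq[OF uv(1)] .
  have "p u \<in> ?S" using ne edge_curve(6)[OF uv(1)] by auto
  moreover have "p u \<notin> inside J" using empty in_arcsD1[OF uv(1)] by auto
  moreover have "?S \<inter> inside J \<noteq> {}" using uv(2) empty in_arcsD2[OF uv(1)] by auto
  moreover have "Topological_Spaces.connected ?S"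
    using connected_arc_minus_pathfinish[OF edge_curve(1)[OF uv(1)]] edge_curve[OF uv(1)] by simp
  ultimately have "?S \<inter> J \<noteq> {}"
    using connected_Int_frontier[of ?S "inside J"] cycle_region[OF xs] J by auto
  then show ?thesis using inner_edge_Int_cycle by auto
qed

end

section \<open>Splitting a cycle by a chord\<close>

text \<open>The chord and the two walks between its ends form a theta curve, whose middle arc
  divides the inside of the outer closed curve into the insides of the two others.\<close>

lemma chord_split:
  assumes dist: "distinct (a # A @ b # B)" and ne: "A \<noteq> []" "B \<noteq> []"
    and W: "walk_arcs (a # A @ [b]) \<subseteq> parcs G" "walk_arcs (b # B @ [a]) \<subseteq> parcs G"
    and ab: "(a, b) \<in> parcs G"
  defines "J \<equiv> curve (walk_arcs (a # A @ [b]) \<union> walk_arcs (b # B @ [a]))"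
    and "J1 \<equiv> curve (cycle_arcs (a # A @ [b]))" and "J2 \<equiv> curve (cycle_arcs (b # B @ [a]))"
  assumes "path_image (\<gamma> (a, b)) \<inter> inside J \<noteq> {}"
  shows "inside J1 \<inter> inside J2 = {}" "inside J1 \<subseteq> inside J" "inside J2 \<subseteq> inside J"
    "path_image (\<gamma> (a, b)) \<subseteq> J1" "path_image (\<gamma> (a, b)) \<subseteq> J2"
proof -
  let ?c = "\<gamma> (a, b)"
  have ba: "(b, a) \<in> parcs G" using ab arc_flip by blast
  obtain c1 where c1: "Path_Connected.arc c1" "pathstart c1 = p a" "pathfinish c1 = p b"
    "path_image c1 = curve (walk_arcs (a # A @ [b]))"
    using walk_curve[of "a # A @ [b]"] dist W by auto
  obtain c2 where c2: "Path_Connected.arc c2" "pathstart c2 = p b" "pathfinish c2 = p a"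
    "path_image c2 = curve (walk_arcs (b # B @ [a]))"
    using walk_curve[of "b # B @ [a]"] dist W by auto
  have J1: "J1 = path_image c1 \<union> path_image ?c"
    using cycle_arcs_conv[of a A b "[]"] edge_curve[OF ab] c1 by (auto simp: J1_def)
  have J2: "J2 = path_image c2 \<union> path_image ?c"
    using cycle_arcs_conv[of b B a "[]"] c2 by (auto simp: J2_def)
  have i12: "path_image c1 \<inter> path_image c2 = {p a, p b}"
    using walk_curves_Int[OF dist ne(1) W] c1 c2 by simp
  have i1: "path_image c1 \<inter> path_image ?c = {p a, p b}"
    using walk_curves_Int[of a A b "[]"] dist ne W ab ba c1 edge_curve[OF ab] by auto
  have i2: "path_image c2 \<inter> path_image ?c = {p a, p b}"
    using walk_curves_Int[of b B a "[]"] dist ne W ab c2 by auto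
  \<comment> \<open>Reversing \<open>c2\<close> makes all three arcs run from \<open>p a\<close> to
    \<open>p b\<close>, the form in which the theorem on theta curves is applied.\<close>
  have J: "J = path_image c1 \<union> path_image (reversepath c2)" using c1 c2 by (simp add: J_def)
  have pab: "p a \<noteq> p b" using edge_ends_neq[OF ab] .
  have "inside (path_image c1 \<union> path_image ?c) \<inter> inside (path_image (reversepath c2) \<union> path_image ?c) = {} \<and>
     inside (path_image c1 \<union> path_image ?c) \<union> inside (path_image (reversepath c2) \<union> path_image ?c) \<union>
           (path_image ?c - {p a, p b}) = inside (path_image c1 \<union> path_image (reversepath c2))"
    by (rule split_inside_simple_closed_curve[of c1 "p a" "p b" "reversepath c2" ?c])
      (use c1 c2 i12 i1 i2 edge_curve[OF ab] pab assms(10) J in \<open>auto simp: arc_imp_simple_path simple_path_reversepath\<close>)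
  then show "inside J1 \<inter> inside J2 = {}" "inside J1 \<subseteq> inside J" "inside J2 \<subseteq> inside J"
    unfolding J1 J2 J by auto
  show "path_image (\<gamma> (a, b)) \<subseteq> J1" "path_image (\<gamma> (a, b)) \<subseteq> J2" by (auto simp: J1 J2)
qed

section \<open>Faces and the number of edges\<close>

lemma curve_subset_drawing: "A \<subseteq> parcs G \<Longrightarrow> curve A \<subseteq> drawing G p \<gamma>"
  by (auto simp: curve_def drawing_def)

text \<open>A connected set that contains \<open>R\<close> and avoids the drawing cannot meet the
  frontier of \<open>R\<close>, hence cannot extend beyond \<open>R\<close>.\<close>

lemma region_in_faces:
  assumes "Topological_Spaces.connected R" "R \<noteq> {}" "R \<inter> drawing G p \<gamma> = {}" "frontier R \<subseteq> drawing G p \<gamma>"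
  shows "R \<in> faces G p \<gamma>"
  unfolding faces_def in_components_maximal
proof (intro conjI allI impI)
  fix D assume D: "D \<noteq> {} \<and> R \<subseteq> D \<and> D \<subseteq> - drawing G p \<gamma> \<and> Topological_Spaces.connected D"
  have "D \<inter> R \<noteq> {}" "D \<inter> frontier R = {}" using D assms(2,4) by blast+
  then have "D - R = {}" using connected_Int_frontier[of D R] D by blast
  then show "D = R" using D by auto
qed (use assms in auto)

text \<open>An interior point of the edge of the cycle that leaves \<open>u\<close> lies on an edge
  of \<open>A\<close>, which must then be the same edge up to direction.\<close>

lemma cycle_vertices_subset:
  assumes "cycle_arcs xs \<subseteq> parcs G" "A \<subseteq> parcs G" "curve (cycle_arcs xs) \<subseteq> curve A"
  shows "set xs \<subseteq> Field A"
proof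
  fix u assume "u \<in> set xs"
  then obtain v where uv: "(u, v) \<in> cycle_arcs xs" using fst_cycle_arcs[of xs] by force
  then have uvG: "(u, v) \<in> parcs G" using assms by auto
  obtain z where z: "z \<in> path_image (\<gamma> (u, v))" "z \<notin> p ` pverts G" using interior_point[OF uvG] .
  then have "z \<in> curve A" using uv assms(3) by (auto simp: curve_def)
  then obtain x y where xy: "(x, y) \<in> A" "z \<in> path_image (\<gamma> (x, y))" by (auto simp: curve_def)
  have "{u, v} = {x, y}"
  proof (rule ccontr)
    assume "{u, v} \<noteq> {x, y}"
    then have "z \<in> p ` ({u, v} \<inter> {x, y})" using edge_curve_Int[of u v x y] uvG xy assms(2) z by auto
    then show False using z in_arcsD1[OF uvG] in_arcsD2[OF uvG] by auto
  qed
  then show "u \<in> Field A" using xy(1) by (auto simp: doubleton_eq_iff Field_def)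
qed

text \<open>The induction is on the number of inner edges: the chord is inside the given cycle but
  on both cycles of the split, so each of these has fewer.\<close>

lemma cycle_length_le_inner_edges:
  assumes tri: "\<And>F. F \<in> faces G p \<gamma> \<Longrightarrow> bounded F \<Longrightarrow> \<exists>T. bounded_by_cycle G \<gamma> F T \<and> length T = 3"
    and xs: "distinct xs" "3 \<le> length xs" "cycle_arcs xs \<subseteq> parcs G"
    and empty: "p ` pverts G \<inter> inside (curve (cycle_arcs xs)) = {}"
  shows "length xs \<le> 3 + card (inner_edges (curve (cycle_arcs xs)))"
  using xs empty
proof (induction "card (inner_edges (curve (cycle_arcs xs)))" arbitrary: xs rule: less_induct)
  case (less xs)
  define J where "J = curve (cycle_arcs xs)"
  note xs = less.prems(1-3) and empty = less.prems(4)[folded J_def]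
  show ?case
  proof (cases "inner_edges J = {}")
    case True
    \<comment> \<open>Neither a vertex nor an edge meets the inside, so it is a bounded face, and
      its frontier \<open>J\<close> is the curve of a triangle.\<close>
    have "inside J \<inter> drawing G p \<gamma> = {}"
      using True empty by (auto simp: drawing_def inner_edges_def)
    then have "inside J \<in> faces G p \<gamma>"
      using cycle_region[OF xs] curve_subset_drawing xs by (intro region_in_faces) (auto simp: J_def)
    then obtain T where T: "graph_cycle G T" "frontier (inside J) = curve (set T)" "length T = 3"
      using tri[of "inside J"] cycle_region[OF xs] by (auto simp: bounded_by_cycle_def curve_def J_def)
    obtain ys where ys: "length ys = length T" "set T = cycle_arcs ys" "cycle_arcs ys \<subseteq> parcs G"
      using graph_cycle_vertex_list[OF T(1)] by metis
    \<comment> \<open>The triangle \<open>ys\<close> covers all of \<open>J\<close>, so every vertex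
      of \<open>xs\<close> is one of its three.\<close>
    have "set xs \<subseteq> Field (cycle_arcs ys)"
      using T ys cycle_region[OF xs] xs by (intro cycle_vertices_subset) (auto simp: J_def)
    then have "card (set xs) \<le> card (set ys)"
      using Field_cycle_arcs_subset[of ys] by (intro card_mono) auto
    then have "length xs \<le> 3" using distinct_card[OF xs(1)] card_length[of ys] ys T by simp
    then show ?thesis by simp
  next
    case False
    then obtain a b where ab: "(a, b) \<in> parcs G" and meets: "path_image (\<gamma> (a, b)) \<inter> inside J \<noteq> {}"
      by (auto simp: inner_edges_def)
    have ba: "(b, a) \<in> parcs G" using ab arc_flip by blast
    have meets': "path_image (\<gamma> (b, a)) \<inter> inside J \<noteq> {}" using edge_curve(5)[OF ab] meets by simp
    have "a \<in> set xs" using inner_edge_start_in_cycle[OF xs empty ab meets J_def] .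
    moreover have "b \<in> set xs" using inner_edge_start_in_cycle[OF xs empty ba meets' J_def] .
    ultimately obtain A B where AB: "distinct (a # A @ b # B)" "length xs = length A + length B + 2"
      "cycle_arcs xs = walk_arcs (a # A @ [b]) \<union> walk_arcs (b # B @ [a])"
      using cycle_arcs_split xs(1) no_loop[OF ab] by metis
    \<comment> \<open>Were one side empty, the chord would itself be an edge of the cycle.\<close>
    have "(a, b) \<in> cycle_arcs xs" if "A = []" using that by (simp add: AB(3))
    moreover have "(b, a) \<in> cycle_arcs xs" if "B = []" using that by (simp add: AB(3))
    ultimately have ne: "A \<noteq> []" "B \<noteq> []"
      using inner_edge_notin_cycle[OF xs empty ab meets J_def] by blast+
    define J1 where "J1 = curve (cycle_arcs (a # A @ [b]))"
    define J2 where "J2 = curve (cycle_arcs (b # B @ [a]))"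
    have split: "inside J1 \<inter> inside J2 = {}" "inside J1 \<subseteq> inside J" "inside J2 \<subseteq> inside J"
      "path_image (\<gamma> (a, b)) \<subseteq> J1" "path_image (\<gamma> (a, b)) \<subseteq> J2"
      using chord_split[OF AB(1) ne _ _ ab] xs(3) meets
      unfolding AB(3) J_def J1_def J2_def by auto
    have ys: "distinct (a # A @ [b])" "3 \<le> length (a # A @ [b])" "cycle_arcs (a # A @ [b]) \<subseteq> parcs G"
      using AB xs(3) ne ba cycle_arcs_conv[of a A b "[]"] by (auto simp: Suc_le_eq)
    have zs: "distinct (b # B @ [a])" "3 \<le> length (b # B @ [a])" "cycle_arcs (b # B @ [a]) \<subseteq> parcs G"
      using AB xs(3) ne ab cycle_arcs_conv[of b B a "[]"] by (auto simp: Suc_le_eq)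
    have empty1: "p ` pverts G \<inter> inside J1 = {}" and empty2: "p ` pverts G \<inter> inside J2 = {}"
      using empty split by auto
    \<comment> \<open>An inner edge lies, up to its ends, within one inside, and the two insides are
      disjoint.\<close>
    have disj: "inner_edges J1 \<inter> inner_edges J2 = {}"
    proof (rule ccontr)
      assume "inner_edges J1 \<inter> inner_edges J2 \<noteq> {}"
      then obtain u v u' v' where uv: "(u, v) \<in> parcs G" "path_image (\<gamma> (u, v)) \<inter> inside J1 \<noteq> {}"
        and uv': "(u', v') \<in> parcs G" "path_image (\<gamma> (u', v')) \<inter> inside J2 \<noteq> {}" and eq: "{u, v} = {u', v'}"
        unfolding inner_edges_def by blast
      have uv2: "path_image (\<gamma> (u, v)) \<inter> inside J2 \<noteq> {}"
        using uv' eq edge_curve(5)[OF uv'(1)] by (auto simp: doubleton_eq_iff)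
      obtain z where "z \<in> path_image (\<gamma> (u, v))" "z \<notin> p ` pverts G" using interior_point[OF uv(1)] .
      then have "z \<in> path_image (\<gamma> (u, v)) - {p u, p v}"
        using in_arcsD1[OF uv(1)] in_arcsD2[OF uv(1)] by auto
      then show False
        using inner_edge_subset_inside[OF ys empty1 uv J1_def]
          inner_edge_subset_inside[OF zs empty2 uv(1) uv2 J2_def] split(1) by blast
    qed
    \<comment> \<open>The chord lies on both \<open>J1\<close> and \<open>J2\<close>, so it is
      counted for neither; it supplies the extra 1 in the fact \<open>card\<close>.\<close>
    have not_inner: "{a, b} \<notin> inner_edges K" if "path_image (\<gamma> (a, b)) \<subseteq> K" for K
    proof
      assume "{a, b} \<in> inner_edges K"
      then obtain u v where uv: "{a, b} = {u, v}" "path_image (\<gamma> (u, v)) \<inter> inside K \<noteq> {}"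
        unfolding inner_edges_def by blast
      have "path_image (\<gamma> (u, v)) = path_image (\<gamma> (a, b))"
        using uv(1) edge_curve(5)[OF ab] by (auto simp: doubleton_eq_iff)
      then show False using uv(2) that inside_no_overlap[of K] by blast
    qed
    have "insert {a, b} (inner_edges J1 \<union> inner_edges J2) \<subseteq> inner_edges J"
      using split ab meets unfolding inner_edges_def by blast
    then have "card (insert {a, b} (inner_edges J1 \<union> inner_edges J2)) \<le> card (inner_edges J)"
      using finite_inner_edges by (rule card_mono[rotated])
    then have card: "1 + card (inner_edges J1) + card (inner_edges J2) \<le> card (inner_edges J)"
      using not_inner split(4,5) disj finite_inner_edges by (simp add: card_Un_disjoint)
    have "length (a # A @ [b]) \<le> 3 + card (inner_edges J1)"
      using less.hyps[OF _ ys] empty1 card by (simp add: J1_def[symmetric] J_def[symmetric])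
    moreover have "length (b # B @ [a]) \<le> 3 + card (inner_edges J2)"
      using less.hyps[OF _ zs] empty2 card by (simp add: J2_def[symmetric] J_def[symmetric])
    \<comment> \<open>The two lengths add up to \<open>length xs + 2\<close>, hence
      \<open>length xs + 2 \<le> 6 + (card (inner_edges J) - 1)\<close>.\<close>
    ultimately show ?thesis using AB(2) card by (simp add: J_def)
  qed
qed

lemma card_edges_ge:
  assumes tri: "\<And>F. F \<in> faces G p \<gamma> \<Longrightarrow> bounded F \<Longrightarrow> \<exists>T. bounded_by_cycle G \<gamma> F T \<and> length T = 3"
    and C: "graph_cycle G C" "fst ` set C = pverts G"
  shows "2 * card (pverts G) \<le> 3 + card ((\<lambda>(u, v). {u, v}) ` parcs G)"
proof -
  let ?e = "\<lambda>(u, v). {u, v}"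
  obtain xs where xs: "distinct xs" "3 \<le> length xs" "cycle_arcs xs \<subseteq> parcs G" and "set C = cycle_arcs xs"
    using graph_cycle_vertex_list[OF C(1)] by metis
  then have V: "set xs = pverts G" using C(2) by (simp add: fst_cycle_arcs)
  let ?J = "curve (cycle_arcs xs)"
  \<comment> \<open>All vertices lie on the Hamiltonian cycle, so none is inside it and the bound on
    inner edges applies.\<close>
  have "p ` pverts G \<subseteq> ?J"
  proof clarify
    fix u assume "u \<in> pverts G"
    then obtain v where uv: "(u, v) \<in> cycle_arcs xs" using fst_cycle_arcs[of xs] V by force
    then have "p u \<in> path_image (\<gamma> (u, v))" using edge_curve(6)[of u v] xs(3) by auto
    then show "p u \<in> ?J" using uv by (auto simp: curve_def)
  qed
  then have empty: "p ` pverts G \<inter> inside ?J = {}" using inside_no_overlap[of ?J] by blast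
  have "inj_on ?e (cycle_arcs xs)"
    using cycle_arcs_antisym[OF xs(1,2)] by (auto simp: inj_on_def doubleton_eq_iff)
  then have "card (pverts G) \<le> card (?e ` cycle_arcs xs)"
    using card_cycle_arcs_ge[OF xs(1)] V distinct_card[OF xs(1)] by (simp add: card_image)
  moreover have "?e ` cycle_arcs xs \<inter> inner_edges ?J = {}"
    using inner_edge_notin_cycle[OF xs empty _ _ refl]
    by (fastforce simp: inner_edges_def doubleton_eq_iff)
  moreover have "?e ` cycle_arcs xs \<union> inner_edges ?J \<subseteq> ?e ` parcs G"
    using xs(3) by (auto simp: inner_edges_def)
  then have "card (?e ` cycle_arcs xs \<union> inner_edges ?J) \<le> card (?e ` parcs G)"
    using pair_finite_arcs by (intro card_mono) auto
  moreover have "finite (?e ` cycle_arcs xs)"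
    using xs(3) pair_finite_arcs finite_subset by blast
  moreover have "card (pverts G) \<le> 3 + card (inner_edges ?J)"
    using cycle_length_le_inner_edges[OF tri xs empty] V distinct_card[OF xs(1)] by simp
  ultimately show ?thesis
    using finite_inner_edges by (simp add: card_Un_disjoint)
qed

end

section \<open>Degrees and deleted edges\<close>

text \<open>The product is homogeneous: each of its monomials arises by picking one variable, an
  element of \<open>V\<close>, from every factor.\<close>

lemma degree_prod_var_diff:
  assumes "finite A" "finite V" "A \<subseteq> V \<times> V"
    and "Poly_Mapping.lookup (\<Prod>(u, v)\<in>A. vertex_var u - vertex_var v) m \<noteq> 0"
  shows "(\<Sum>x\<in>V. Poly_Mapping.lookup m x) = card A"
  using assms(1,3,4)
proof (induction A arbitrary: m rule: finite_induct)
  case empty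
  then have "m = 0" by (simp add: lookup_one when_def split: if_splits)
  then show ?case by simp
next
  case (insert a A)
  obtain u v where a: "a = (u, v)" by (cases a)
  let ?P = "\<Prod>(u, v)\<in>A. vertex_var u - vertex_var v :: 'a vertex_poly"
  have "m \<in> Poly_Mapping.keys ((vertex_var u - vertex_var v) * ?P)"
    using insert.prems(2) insert.hyps by (simp add: a in_keys_iff)
  then obtain s t where m: "m = s + t" and s: "s \<in> Poly_Mapping.keys (vertex_var u - vertex_var v)"
    and t: "t \<in> Poly_Mapping.keys ?P"
    using keys_mult by blast
  have "s \<in> {Poly_Mapping.single u 1, Poly_Mapping.single v 1}"
    using s keys_diff[of "vertex_var u" "vertex_var v"] by (auto simp: vertex_var_def)
  then obtain w where w: "w \<in> V" "s = Poly_Mapping.single w 1"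
    using insert.prems(1) a by auto
  have "(\<Sum>x\<in>V. Poly_Mapping.lookup s x) = 1"
    using w \<open>finite V\<close> by (simp add: lookup_single when_def)
  moreover have "(\<Sum>x\<in>V. Poly_Mapping.lookup t x) = card A"
    using insert.IH[of t] insert.prems t by (simp add: in_keys_iff)
  ultimately show ?case
    using insert.hyps by (simp add: m lookup_add sum.distrib)
qed

text \<open>Every edge that is not deleted keeps both arcs, of which \<open>r\<close> selects one,
  and at most two edges are deleted.\<close>

lemma card_oriented_arcs_delete_path_ge:
  fixes G :: "'a pair_pre_digraph"
  assumes G: "pair_graph G" and r: "orients r G"
  shows "card ((\<lambda>(u, v). {u, v}) ` parcs G) \<le> card {(u, v) \<in> parcs (delete_path G x y z). r u v} + 2"
proof -
  interpret pair_graph G by fact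
  let ?e = "\<lambda>(u, v). {u, v}" and ?A = "{(u, v) \<in> parcs (delete_path G x y z). r u v}"
  have fin: "finite ?A" by (rule finite_subset[OF _ pair_finite_arcs]) (auto simp: delete_path_def)
  have "?e ` parcs G \<subseteq> ?e ` ?A \<union> {{x, y}, {y, z}}"
  proof
    fix e assume "e \<in> ?e ` parcs G"
    then obtain u v where uv: "(u, v) \<in> parcs G" and e: "e = {u, v}" by auto
    have vu: "(v, u) \<in> parcs G" using uv pair_sym_arcs by (auto simp: symmetric_def sym_def)
    have "r u v \<or> r v u" using r uv by (auto simp: orients_def)
    then have "(u, v) \<in> ?A \<or> (v, u) \<in> ?A" if "e \<notin> {{x, y}, {y, z}}"
      using that uv vu by (auto simp: e delete_path_def insert_commute)
    moreover have "(u, v) \<in> ?A \<Longrightarrow> e \<in> ?e ` ?A" unfolding e by (erule rev_image_eqI) simp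
    moreover have "(v, u) \<in> ?A \<Longrightarrow> e \<in> ?e ` ?A" unfolding e by (erule rev_image_eqI) (simp add: insert_commute)
    ultimately show "e \<in> ?e ` ?A \<union> {{x, y}, {y, z}}" unfolding Un_iff by argo
  qed
  then have "card (?e ` parcs G) \<le> card (?e ` ?A \<union> {{x, y}, {y, z}})"
    using fin by (intro card_mono) auto
  also have "\<dots> \<le> card (?e ` ?A) + card {{x, y}, {y, z}}" by (rule card_Un_le)
  \<comment> \<open>The two deleted pairs coincide if \<open>x = z\<close>, so their number is only
    bounded by 2.\<close>
  also have "\<dots> \<le> card ?A + 2"
    using card_image_le[OF fin, of ?e] card_insert_le_m1[of 2 "{{y, z}}" "{x, y}"] by simp
  finally show ?thesis .
qed

theorem theorem5p4:
  fixes G :: "'a pair_pre_digraph"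
    and p :: "'a \<Rightarrow> complex" and \<gamma> :: "'a \<times> 'a \<Rightarrow> real \<Rightarrow> complex"
    and k :: nat and v :: "nat \<Rightarrow> 'a"
    and C :: "('a \<times> 'a) list" and r :: "'a \<Rightarrow> 'a \<Rightarrow> bool"
  assumes "outerplanar_near_triangulation G p \<gamma>"
    and "bij_betw v {1..k} (pverts G)"
    and "outer_cycle G p \<gamma> C"
    and "(v k, v 1) \<in> set C" and "(v 1, v 2) \<in> set C"
    and "orients r G"
  shows "\<not> (\<exists>m :: 'a \<Rightarrow>\<^sub>0 nat.
           Poly_Mapping.keys m \<subseteq> pverts G \<and>
           Poly_Mapping.lookup m (v 1) = 0 \<and> Poly_Mapping.lookup m (v 2) = 0 \<and>
           Poly_Mapping.lookup m (v k) = 0 \<and>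
           (\<forall>i \<in> {3..k-1}. Poly_Mapping.lookup m (v i) \<le> 2) \<and>
           contains_monomial (graph_poly r (delete_path G (v k) (v 1) (v 2))) m)"
proof (rule notI, elim exE conjE)
  fix m :: "'a \<Rightarrow>\<^sub>0 nat"
  let ?H = "delete_path G (v k) (v 1) (v 2)"
  let ?A = "{(x, y) \<in> parcs ?H. r x y}"
  assume m: "Poly_Mapping.lookup m (v 1) = 0" "Poly_Mapping.lookup m (v 2) = 0"
    "Poly_Mapping.lookup m (v k) = 0" "\<forall>i \<in> {3..k-1}. Poly_Mapping.lookup m (v i) \<le> 2"
    and contains: "contains_monomial (graph_poly r ?H) m"
  note near = assms(1)[unfolded outerplanar_near_triangulation_def]
  have G: "pair_graph G" and embedding: "plane_embedding G p \<gamma>"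
    and two: "two_connected G" and ex: "\<exists>C. outer_cycle G p \<gamma> C \<and> fst ` set C = pverts G"
    and "\<forall>F\<in>faces G p \<gamma>. bounded F \<longrightarrow> (\<exists>T. bounded_by_cycle G \<gamma> F T \<and> length T = 3)"
    using near by simp_all
  then have tri: "\<And>F. F \<in> faces G p \<gamma> \<Longrightarrow> bounded F \<Longrightarrow> \<exists>T. bounded_by_cycle G \<gamma> F T \<and> length T = 3"
    by blast
  have three: "3 \<le> card (pverts G)" using two by (simp add: two_connected_def)
  obtain D where D: "graph_cycle G D" "fst ` set D = pverts G"
    using ex unfolding outer_cycle_def bounded_by_cycle_def by blast
  interpret pair_graph G by (fact G)
  interpret plane_graph G p \<gamma> by unfold_locales (fact embedding)
  have k: "card (pverts G) = k" using bij_betw_same_card[OF assms(2)] by simp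
  \<comment> \<open>For the number \<open>e\<close> of edges, \<open>2 * k \<le> 3 + e\<close> and
    \<open>e \<le> card ?A + 2\<close>.\<close>
  have "2 * k \<le> card ?A + 5"
    using card_edges_ge[OF tri D] card_oriented_arcs_delete_path_ge[OF G assms(6), of "v k" "v 1" "v 2"] k
    by simp
  moreover have "finite ?A"
    by (rule finite_subset[OF _ pair_finite_arcs]) (auto simp: delete_path_def)
  then have "(\<Sum>x\<in>pverts G. Poly_Mapping.lookup m x) = card ?A"
    using contains pair_finite_verts in_arcsD1 in_arcsD2
    by (intro degree_prod_var_diff) (auto simp: contains_monomial_def graph_poly_def delete_path_def)
  moreover have "(\<Sum>x\<in>pverts G. Poly_Mapping.lookup m x) = (\<Sum>i\<in>{1..k}. Poly_Mapping.lookup m (v i))"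
    using sum.reindex_bij_betw[OF assms(2)] by metis
  moreover have "\<dots> = (\<Sum>i\<in>{3..k-1}. Poly_Mapping.lookup m (v i))"
  proof (rule sum.mono_neutral_right)
    show "\<forall>i\<in>{1..k} - {3..k - 1}. Poly_Mapping.lookup m (v i) = 0"
    proof
      fix i assume "i \<in> {1..k} - {3..k - 1}"
      then have "i = 1 \<or> i = 2 \<or> i = k" by auto
      then show "Poly_Mapping.lookup m (v i) = 0" using m by auto
    qed
  qed auto
  \<comment> \<open>Since \<open>3 \<le> k\<close>, the range has \<open>k - 3\<close> elements, so
    the degree is at most \<open>2 * k - 6\<close>, against the lower bound
    \<open>2 * k - 5\<close>.\<close>
  moreover have "\<dots> \<le> card {3..k-1} * 2" 
    using sum_bounded_above[of "{3..k-1}" "\<lambda>i. Poly_Mapping.lookup m (v i)" 2] m(4) by simp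
  ultimately show False using three k by simp
qed

end
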